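(* In the logistic regression model with linear restrictions $H\beta=h$, let $0<d<1$, $L_d=I-(1-d)^2(C+I)^{-2}$, $A=C^{-1}-C^{-1}H'(HC^{-1}H')^{-1}HC^{-1}$ and $b_1=(L_d-I)\beta$. Assume that $\lambda_{max}(L_dAL_dC)\le 1$. Then $\hat\beta_{RAULE}$ is superior to $\hat\beta_{MLE}$ in the MMSE sense, i.e. $MMSE(\hat\beta_{MLE})-MMSE(\hat\beta_{RAULE})\ge 0$, if and only if $$b_1'(C^{-1}-L_dAL_d)^+b_1\le 1\quad\text{and}\quad b_1\in\Re(C^{-1}-L_dAL_d).$$
   Context: Logistic regression model: $y_i=\pi_i+\varepsilon_i$, $i=1,\dots,n$, with $y_i$ Bernoulli of parameter $\pi_i=\exp(x_i'\beta)/(1+\exp(x_i'\beta))$, where $\beta\in\mathbb{R}^{p+1}$ is the unknown coefficient vector and $x_i'$ is the $i$th row of the $n\times(p+1)$ data matrix $X$. A prime denotes transpose. Let $C=X'\hat WX$, where $\hat W=\mathrm{Diag}(\hat\pi_i(1-\hat\pi_i))$. Convention (usual large-sample treatment): $C$ is a fixed symmetric positive definite $(p+1)\times(p+1)$ matrix, and the maximum likelihood estimator $\hat\beta_{MLE}$ is a random vector in $\mathbb{R}^{p+1}$ with $E(\hat\beta_{MLE})=\beta$ and $Cov(\hat\beta_{MLE})=C^{-1}$; no other property of the model is used. $H$ is a known $q\times(p+1)$ matrix of full row rank $q\le p+1$, $h\in\mathbb{R}^q$ is known, and the restrictions $H\beta=h$ are assumed to hold. The restricted MLE is $$\hat\beta_{RMLE}=\hat\beta_{MLE}-C^{-1}H'(HC^{-1}H')^{-1}(H\hat\beta_{MLE}-h),$$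 and the restricted almost unbiased Liu estimator is $\hat\beta_{RAULE}=L_d\hat\beta_{RMLE}$. For an estimator $\hat\theta$ of $\theta$, $MMSE(\hat\theta)=E[(\hat\theta-\theta)(\hat\theta-\theta)']$. For symmetric $M$, $M\ge 0$ means $M$ is nonnegative definite. $\Re(M)$ is the column space of $M$, $M^+$ the Moore–Penrose inverse, and $\lambda_{max}$ the largest eigenvalue (the eigenvalues of $L_dAL_dC$ are real, as it is a product of a nonnegative definite and a positive definite matrix). *)

theory Defs
  imports "HOL-Probability.Probability"
begin

definition symmetric_matrix :: "real^'n^'n \<Rightarrow> bool" where
  "symmetric_matrix M \<longleftrightarrow> transpose M = M"

definition nonneg_definite :: "real^'n^'n \<Rightarrow> bool" where
  "nonneg_definite M \<longleftrightarrow> symmetric_matrix M \<and> (\<forall>v. 0 \<le> v \<bullet> (M *v v))"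

definition pos_definite :: "real^'n^'n \<Rightarrow> bool" where
  "pos_definite M \<longleftrightarrow> symmetric_matrix M \<and> (\<forall>v. v \<noteq> 0 \<longrightarrow> 0 < v \<bullet> (M *v v))"

definition column_space :: "real^'n^'m \<Rightarrow> (real^'m) set" where
  "column_space M = span (columns M)"

(* The real eigenvalues. For the product of a nonnegative definite and a positive definite
   matrix, these are all the eigenvalues. *)
definition eigenvalues :: "real^'n^'n \<Rightarrow> real set" where
  "eigenvalues M = {l. \<exists>v. v \<noteq> 0 \<and> M *v v = l *\<^sub>R v}"

definition lambda_max :: "real^'n^'n \<Rightarrow> real" where
  "lambda_max M = Max (eigenvalues M)"

(* The four Penrose equations; over the reals, the adjoint is the transpose. *)
definition is_moore_penrose :: "real^'n^'m \<Rightarrow> real^'m^'n \<Rightarrow> bool" where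
  "is_moore_penrose M G \<longleftrightarrow>
     M ** G ** M = M \<and> G ** M ** G = G \<and>
     transpose (M ** G) = M ** G \<and> transpose (G ** M) = G ** M"

definition moore_penrose :: "real^'n^'m \<Rightarrow> real^'m^'n" where
  "moore_penrose M = (THE G. is_moore_penrose M G)"

definition outer :: "real^'m \<Rightarrow> real^'n \<Rightarrow> real^'n^'m" where
  "outer u v = (\<chi> i j. u $ i * v $ j)"

(* The vector- and matrix-valued expectations are Bochner integrals, which are zero for
   non-integrable functions; square integrability has to be assumed separately. *)
definition cov_matrix :: "'a measure \<Rightarrow> ('a \<Rightarrow> real^'n) \<Rightarrow> real^'n^'n" where
  "cov_matrix M X =
     (\<integral>\<omega>. outer (X \<omega> - (\<integral>\<omega>'. X \<omega>' \<partial>M)) (X \<omega> - (\<integral>\<omega>'. X \<omega>' \<partial>M)) \<partial>M)"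

definition mmse :: "'a measure \<Rightarrow> ('a \<Rightarrow> real^'n) \<Rightarrow> real^'n \<Rightarrow> real^'n^'n" where
  "mmse M est \<theta> = (\<integral>\<omega>. outer (est \<omega> - \<theta>) (est \<omega> - \<theta>) \<partial>M)"

definition mmse_superior ::
  "'a measure \<Rightarrow> real^'n \<Rightarrow> ('a \<Rightarrow> real^'n) \<Rightarrow> ('a \<Rightarrow> real^'n) \<Rightarrow> bool" where
  "mmse_superior M \<theta> est1 est2 \<longleftrightarrow> nonneg_definite (mmse M est2 \<theta> - mmse M est1 \<theta>)"

definition liu_matrix :: "real^'n^'n \<Rightarrow> real \<Rightarrow> real^'n^'n" where
  "liu_matrix C d =
     mat 1 - (1 - d)\<^sup>2 *\<^sub>R (matrix_inv (C + mat 1) ** matrix_inv (C + mat 1))"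

definition restr_matrix :: "real^'n^'n \<Rightarrow> real^'n^'q \<Rightarrow> real^'n^'n" where
  "restr_matrix C H =
     matrix_inv C - matrix_inv C ** transpose H **
       matrix_inv (H ** matrix_inv C ** transpose H) ** H ** matrix_inv C"

(* The restricted maximum likelihood estimate, as a function of the value b of the
   unrestricted one. *)
definition rmle :: "real^'n^'n \<Rightarrow> real^'n^'q \<Rightarrow> real^'q \<Rightarrow> real^'n \<Rightarrow> real^'n" where
  "rmle C H h b =
     b - (matrix_inv C ** transpose H ** matrix_inv (H ** matrix_inv C ** transpose H))
           *v (H *v b - h)"

definition raule ::
  "real^'n^'n \<Rightarrow> real^'n^'q \<Rightarrow> real^'q \<Rightarrow> real \<Rightarrow> real^'n \<Rightarrow> real^'n" where
  "raule C H h d b = liu_matrix C d *v rmle C H h b"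

end

theory Submission
  imports Defs
begin

text \<open>Put \<open>D = C\<^sup>-\<^sup>1 - LAL\<close>. Under \<open>H\<beta> = h\<close> the estimation error of the RAULE is an affine function of
  that of the MLE, and the difference of the two MMSE matrices is \<open>D - b\<^sub>1b\<^sub>1'\<close>. The matrix \<open>L\<close>
  commutes with \<open>C\<close> and has its spectrum in \<open>(0, 1)\<close>, and \<open>A \<le> C\<^sup>-\<^sup>1\<close>, so that
  \<open>LAL \<le> LC\<^sup>-\<^sup>1L < C\<^sup>-\<^sup>1\<close>. Hence \<open>D\<close> is positive definite, its Moore--Penrose inverse is
  \<open>D\<^sup>-\<^sup>1\<close> and its column space is everything; and \<open>D - b\<^sub>1b\<^sub>1' \<ge> 0\<close> is equivalent to
  \<open>b\<^sub>1'D\<^sup>-\<^sup>1b\<^sub>1 \<le> 1\<close> by the Cauchy--Schwarz inequality for \<open>D\<close>.\<close>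

section \<open>Symmetric and positive definite matrices\<close>

lemma matrix_inv_right:
  fixes A :: "'a::semiring_1^'n^'m"
  assumes "invertible A"
  shows "A ** matrix_inv A = mat 1"
  using assms unfolding invertible_def matrix_inv_def by (rule someI2_ex) simp

lemma matrix_inv_left:
  fixes A :: "'a::semiring_1^'n^'m"
  assumes "invertible A"
  shows "matrix_inv A ** A = mat 1"
  using assms unfolding invertible_def matrix_inv_def by (rule someI2_ex) simp

lemma matrix_inv_vector_right:
  fixes A :: "real^'n^'n"
  assumes "invertible A"
  shows "A *v (matrix_inv A *v x) = x"
  by (simp add: matrix_vector_mul_assoc matrix_inv_right assms)

lemma matrix_inv_vector_left:
  fixes A :: "real^'n^'n"
  assumes "invertible A"
  shows "matrix_inv A *v (A *v x) = x"
  by (simp add: matrix_vector_mul_assoc matrix_inv_left assms)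

lemma transpose_add: "transpose (A + B) = transpose A + transpose B"
  by (simp add: transpose_def vec_eq_iff)

lemma transpose_diff: "transpose (A - B) = transpose A - transpose B"
  by (simp add: transpose_def vec_eq_iff)

lemma matrix_add_rdistrib: "(A + B) ** C = A ** C + B ** C"
  by (simp add: matrix_matrix_mult_def vec_eq_iff distrib_right sum.distrib)

lemma inner_transpose_matrix_vector:
  fixes A :: "real^'n^'m"
  shows "x \<bullet> (transpose A *v y) = (A *v x) \<bullet> y"
  by (metis dot_lmul_matrix vector_transpose_matrix)

lemma symmetric_matrix_inner:
  assumes "symmetric_matrix A"
  shows "x \<bullet> (A *v y) = (A *v x) \<bullet> y"
  using inner_transpose_matrix_vector[of x A y] assms by (simp only: symmetric_matrix_def)

lemma symmetric_matrix_inv: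
  fixes A :: "real^'n^'n"
  assumes "symmetric_matrix A" "invertible A"
  shows "symmetric_matrix (matrix_inv A)"
proof -
  have "transpose (matrix_inv A) ** A = transpose (A ** matrix_inv A)"
    using assms(1) by (simp add: matrix_transpose_mul symmetric_matrix_def)
  then have "transpose (matrix_inv A) ** A = mat 1"
    by (simp add: matrix_inv_right assms(2))
  then have "transpose (matrix_inv A) ** (A ** matrix_inv A) = matrix_inv A"
    by (simp add: matrix_mul_assoc)
  then show ?thesis
    by (simp add: matrix_inv_right assms(2) symmetric_matrix_def)
qed

lemma pos_definite_symmetric: "pos_definite A \<Longrightarrow> symmetric_matrix A"
  by (simp add: pos_definite_def)

lemma pos_definite_nonneg: "pos_definite A \<Longrightarrow> 0 \<le> v \<bullet> (A *v v)"
  unfolding pos_definite_def by (cases "v = 0") (auto intro: less_imp_le)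

lemma pos_definite_invertible:
  assumes "pos_definite A"
  shows "invertible A"
proof -
  have "\<forall>x. A *v x = 0 \<longrightarrow> x = 0"
    using assms unfolding pos_definite_def by force
  then show ?thesis
    unfolding invertible_left_inverse matrix_left_invertible_ker .
qed

text \<open>Substituting \<open>v = A *v w\<close> turns the quadratic form of the inverse at
  \<open>v\<close> into that of \<open>A\<close> at \<open>w\<close>.\<close>

lemma pos_definite_matrix_inv:
  assumes "pos_definite A"
  shows "pos_definite (matrix_inv A)"
  unfolding pos_definite_def
proof (intro conjI allI impI)
  have inv: "invertible A"
    using assms by (rule pos_definite_invertible)
  show "symmetric_matrix (matrix_inv A)"
    by (rule symmetric_matrix_inv[OF pos_definite_symmetric[OF assms] inv])
  fix v :: "real^'a"
  assume "v \<noteq> 0"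
  define w where "w = matrix_inv A *v v"
  have v: "v = A *v w"
    by (simp add: w_def matrix_inv_vector_right inv)
  with \<open>v \<noteq> 0\<close> have "w \<noteq> 0"
    by auto
  with assms have "0 < w \<bullet> (A *v w)"
    by (simp add: pos_definite_def)
  then show "0 < v \<bullet> (matrix_inv A *v v)"
    by (simp add: inner_commute v matrix_inv_vector_left inv)
qed

lemma pos_definite_add_mat_1:
  assumes "pos_definite C"
  shows "pos_definite (C + mat 1)"
  using assms
  by (auto simp: pos_definite_def symmetric_matrix_def transpose_add
      matrix_vector_mult_add_rdistrib inner_add_right intro: add_pos_pos)

text \<open>Full row rank makes the transpose of \<open>H\<close> injective. With \<open>P\<close>
  the inverse of \<open>C\<close>, the matrix inverted in \<open>restr_matrix\<close> and
  \<open>rmle\<close> is therefore positive definite, and its \<open>matrix_inv\<close> is a genuine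
  inverse.\<close>

lemma pos_definite_congruence:
  fixes P :: "real^'n^'n" and H :: "real^'n^'q"
  assumes "pos_definite P" "rank H = CARD('q)"
  shows "pos_definite (H ** P ** transpose H)"
  unfolding pos_definite_def
proof (intro conjI allI impI)
  show "symmetric_matrix (H ** P ** transpose H)"
    using assms(1)
    by (simp add: pos_definite_def symmetric_matrix_def matrix_transpose_mul matrix_mul_assoc)
  fix v :: "real^'q"
  assume "v \<noteq> 0"
  have "inj ((*v) (transpose H))"
    unfolding full_rank_injective[symmetric] rank_transpose by (rule assms(2))
  with \<open>v \<noteq> 0\<close> have "transpose H *v v \<noteq> 0"
    by (metis injD matrix_vector_mult_0_right)
  with assms(1) have "0 < (transpose H *v v) \<bullet> (P *v (transpose H *v v))"
    unfolding pos_definite_def by blast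
  also have "\<dots> = v \<bullet> (H *v (P *v (transpose H *v v)))"
    using inner_transpose_matrix_vector[of v "transpose H"] by (simp only: transpose_transpose)
  finally show "0 < v \<bullet> ((H ** P ** transpose H) *v v)"
    by (simp only: matrix_vector_mul_assoc matrix_mul_assoc)
qed

text \<open>Multiplying the first Penrose equation by the inverse of \<open>D\<close> on both sides
  determines \<open>G\<close>, which gives the uniqueness that the definite description
  requires.\<close>

lemma moore_penrose_invertible:
  fixes D :: "real^'n^'n"
  assumes "invertible D"
  shows "moore_penrose D = matrix_inv D"
  unfolding moore_penrose_def
proof (rule the_equality)
  show "is_moore_penrose D (matrix_inv D)"
    by (simp add: is_moore_penrose_def matrix_inv_left matrix_inv_right assms)
  fix G
  assume "is_moore_penrose D G"
  then have "D ** G ** D = D"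
    by (simp add: is_moore_penrose_def)
  then have "matrix_inv D ** (D ** G ** D) ** matrix_inv D = matrix_inv D ** D ** matrix_inv D"
    by simp
  then have "(matrix_inv D ** D) ** G ** (D ** matrix_inv D) = matrix_inv D ** D ** matrix_inv D"
    by (simp only: matrix_mul_assoc)
  then show "G = matrix_inv D"
    by (simp add: matrix_inv_left matrix_inv_right assms)
qed

lemma column_space_invertible:
  fixes D :: "real^'n^'n"
  assumes "invertible D"
  shows "column_space D = UNIV"
  using assms
  unfolding column_space_def invertible_right_inverse matrix_right_invertible_span_columns
  by (simp add: span_vec_eq)

section \<open>Outer products\<close>

lemma outer_vector_mult: "outer u v *v x = (v \<bullet> x) *\<^sub>R u"
  by (simp add: outer_def vec_eq_iff matrix_vector_mult_def inner_vec_def sum_distrib_left mult_ac)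

lemma symmetric_matrix_outer: "symmetric_matrix (outer b b)"
  by (simp add: symmetric_matrix_def outer_def transpose_def vec_eq_iff)

text \<open>The norm on matrices is the Euclidean norm of the row norms (the Frobenius norm), and
  each row here is a multiple of \<open>v\<close>.\<close>

lemma norm_outer: "norm (outer u v) = norm u * norm v"
proof -
  have "outer u v = (\<chi> i. (u $ i) *\<^sub>R v)"
    by (simp add: outer_def vec_eq_iff)
  then show ?thesis
    by (simp add: norm_vec_def[of "\<chi> i. (u $ i) *\<^sub>R v"] norm_vec_def[of u] L2_set_left_distrib)
qed

text \<open>Lets expectations pass through either argument of an outer product; by
  \<open>norm_outer\<close> the bounding constant is 1.\<close>

lemma bounded_bilinear_outer: "bounded_bilinear outer"
  by standard
    (auto simp: outer_def vec_eq_iff algebra_simps norm_outer[unfolded outer_def]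
      intro!: exI[of _ 1])

lemma outer_matrix_vector: "outer (T *v u) (T *v v) = T ** outer u v ** transpose T"
  unfolding matrix_eq
proof
  fix x
  have "(T *v v) \<bullet> x = v \<bullet> (transpose T *v x)"
    by (simp only: inner_transpose_matrix_vector)
  then show "outer (T *v u) (T *v v) *v x = (T ** outer u v ** transpose T) *v x"
    by (simp only: outer_vector_mult matrix_vector_mult_scaleR flip: matrix_vector_mul_assoc)
qed

text \<open>The Cauchy--Schwarz inequality for \<open>D\<close> is sharp at \<open>w = D\<^sup>-\<^sup>1 b\<close>.\<close>

lemma nonneg_definite_diff_outer_iff:
  assumes "pos_definite D"
  shows "nonneg_definite (D - outer b b) \<longleftrightarrow> b \<bullet> (matrix_inv D *v b) \<le> 1"
proof -
  define w where "w = matrix_inv D *v b"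
  define t where "t = b \<bullet> w"
  have b: "D *v w = b"
    using assms by (simp add: w_def matrix_inv_vector_right pos_definite_invertible)
  have sym: "symmetric_matrix D"
    using assms by (rule pos_definite_symmetric)
  have quad: "v \<bullet> ((D - outer b b) *v v) = v \<bullet> (D *v v) - (b \<bullet> v)\<^sup>2" for v
    by (simp add: matrix_vector_mult_diff_rdistrib outer_vector_mult inner_diff_right
        inner_commute power2_eq_square)
  have "t \<le> 1" if "nonneg_definite (D - outer b b)"
  proof -
    \<comment> \<open>Evaluation of \<open>quad\<close> at \<open>w\<close>, where w'Dw = w'b =
      t.\<close>
    have "0 \<le> t - t\<^sup>2"
      using that quad[of w] unfolding nonneg_definite_def
      by (metis b inner_commute t_def)
    then have "t * t \<le> t * 1"
      by (simp add: power2_eq_square)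
    then show ?thesis
      \<comment> \<open>Cancelling \<open>t\<close> requires \<open>t > 0\<close>, which holds in
        the case to be excluded, \<open>t > 1\<close>.\<close>
      by (metis linorder_not_le mult_less_cancel_left_pos not_less_iff_gr_or_eq zero_less_one less_trans)
  qed
  moreover have "nonneg_definite (D - outer b b)" if "t \<le> 1"
    unfolding nonneg_definite_def quad
  proof (intro conjI allI)
    show "symmetric_matrix (D - outer b b)"
      using sym symmetric_matrix_outer[of b] by (simp add: symmetric_matrix_def transpose_diff)
    fix v
    \<comment> \<open>Completing the square: nonnegativity of the form of \<open>D\<close> at
      \<open>v - s *\<^sub>R w\<close> gives v'Dv >= 2s^2 - s^2 t, and t <= 1 makes the right side
      at least s^2.\<close>
    define s where "s = b \<bullet> v"
    have "w \<bullet> (D *v v) = s"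
      by (simp add: symmetric_matrix_inner[OF sym] b s_def)
    then have "(v - s *\<^sub>R w) \<bullet> (D *v (v - s *\<^sub>R w)) = v \<bullet> (D *v v) - 2 * s\<^sup>2 + s\<^sup>2 * t"
      by (simp add: algebra_simps inner_diff_left inner_diff_right b inner_commute[of _ b]
          matrix_vector_mult_diff_distrib matrix_vector_mult_scaleR power2_eq_square
          flip: s_def t_def)
    moreover have "s\<^sup>2 * t \<le> s\<^sup>2"
      using that by (simp add: mult_left_le)
    ultimately show "0 \<le> v \<bullet> (D *v v) - (b \<bullet> v)\<^sup>2"
      using pos_definite_nonneg[OF assms, of "v - s *\<^sub>R w"] by (simp add: s_def)
  qed
  ultimately show ?thesis
    by (auto simp: t_def w_def)
qed

section \<open>The Liu and restriction matrices\<close>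

lemma liu_matrix_vector:
  "liu_matrix C d *v v =
    v - (1 - d)\<^sup>2 *\<^sub>R (matrix_inv (C + mat 1) *v (matrix_inv (C + mat 1) *v v))"
  by (simp add: liu_matrix_def matrix_vector_mult_diff_rdistrib matrix_vector_mul_assoc
      flip: scaleR_matrix_vector_assoc)

lemma symmetric_liu_matrix:
  assumes "pos_definite C"
  shows "symmetric_matrix (liu_matrix C d)"
proof -
  have "pos_definite (C + mat 1)"
    using assms by (rule pos_definite_add_mat_1)
  then have "symmetric_matrix (matrix_inv (C + mat 1))"
    by (intro pos_definite_symmetric pos_definite_matrix_inv)
  then show ?thesis
    by (simp add: symmetric_matrix_def liu_matrix_def transpose_diff transpose_scalar
        matrix_transpose_mul)
qed

text \<open>With \<open>c = (1 - d)\<^sup>2\<close> and \<open>x = (C + I)\<^sup>-\<^sup>2 v\<close>, the difference of the two sides is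
  \<open>2c (x'Cx + 2x'x) + c(2 - c) x'C\<^sup>-\<^sup>1x\<close>.\<close>

lemma liu_matrix_contraction:
  assumes C: "pos_definite C" and d: "0 < d" "d < 1" and "v \<noteq> 0"
  shows "(liu_matrix C d *v v) \<bullet> (matrix_inv C *v (liu_matrix C d *v v))
    < v \<bullet> (matrix_inv C *v v)"
proof -
  define P where "P = matrix_inv C"
  define c where "c = (1 - d)\<^sup>2"
  define u where "u = matrix_inv (C + mat 1) *v v"
  define x where "x = matrix_inv (C + mat 1) *v u"
  have inv: "invertible C" "invertible (C + mat 1)"
    using C pos_definite_add_mat_1[OF C] by (auto intro: pos_definite_invertible)
  \<comment> \<open>Undoing both inverses gives v = (C + I)^2 x, so the terms to be compared become
    forms in \<open>x\<close>.\<close>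
  have u: "u = C *v x + x"
    using matrix_inv_vector_right[OF inv(2), of u]
    by (simp add: x_def matrix_vector_mult_add_rdistrib)
  have v: "v = C *v u + u"
    using matrix_inv_vector_right[OF inv(2), of v]
    by (simp add: u_def matrix_vector_mult_add_rdistrib)
  have P: "pos_definite P"
    unfolding P_def using C by (rule pos_definite_matrix_inv)
  have "x \<noteq> 0"
    using \<open>v \<noteq> 0\<close> v u by auto
  then have pos: "0 < x \<bullet> (P *v x)" "0 < x \<bullet> (C *v x)"
    using P C by (auto simp: pos_definite_def)
  \<comment> \<open>Symmetry moves \<open>C\<close> across the inner product, where it cancels
    against \<open>P\<close>.\<close>
  have CP: "(C *v y) \<bullet> (P *v x) = y \<bullet> x" for y
    using symmetric_matrix_inner[OF pos_definite_symmetric[OF C], of y "P *v x"]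
    by (simp add: P_def matrix_inv_vector_right inv)
  have vPx: "v \<bullet> (P *v x) = x \<bullet> (C *v x) + 2 * (x \<bullet> x) + x \<bullet> (P *v x)"
  proof -
    have "v \<bullet> (P *v x) = u \<bullet> x + u \<bullet> (P *v x)"
      by (simp only: v inner_add_left CP)
    also have "u \<bullet> (P *v x) = x \<bullet> x + x \<bullet> (P *v x)"
      by (simp only: u inner_add_left CP)
    finally show ?thesis
      by (simp add: u inner_add_left inner_commute[of "C *v x" x])
  qed
  have "x \<bullet> (P *v v) = v \<bullet> (P *v x)"
    by (metis P inner_commute pos_definite_symmetric symmetric_matrix_inner)
  \<comment> \<open>The vector \<open>v - c *\<^sub>R x\<close> is the Liu matrix applied to
    \<open>v\<close>. What remains is c^2 x'Px < 2c v'Px, shown with c x'Px in between.\<close>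
  then have "(v - c *\<^sub>R x) \<bullet> (P *v (v - c *\<^sub>R x))
      = v \<bullet> (P *v v) - 2 * c * (v \<bullet> (P *v x)) + c * c * (x \<bullet> (P *v x))"
    by (simp add: matrix_vector_mult_diff_distrib matrix_vector_mult_scaleR inner_diff_left
        inner_diff_right algebra_simps)
  moreover have c: "0 < c" "c < 1"
    using d by (auto simp: c_def abs_square_less_1)
  have "c * c * (x \<bullet> (P *v x)) \<le> c * (x \<bullet> (P *v x))"
    using c pos by simp
  moreover have "c * (x \<bullet> (P *v x)) < 2 * c * (v \<bullet> (P *v x))"
  proof -
    have "x \<bullet> (P *v x) < 2 * (v \<bullet> (P *v x))"
      unfolding vPx using pos inner_ge_zero[of x] by argo
    with c have "c * (x \<bullet> (P *v x)) < c * (2 * (v \<bullet> (P *v x)))"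
      by (intro mult_strict_left_mono)
    then show ?thesis
      by simp
  qed
  ultimately show ?thesis
    by (simp add: liu_matrix_vector flip: P_def c_def u_def x_def)
qed

section \<open>Comparison of the restriction matrix with the inverse of \<open>C\<close>\<close>

lemma symmetric_restr_matrix:
  fixes H :: "real^'n^'q"
  assumes "pos_definite C" "rank H = CARD('q)"
  shows "symmetric_matrix (restr_matrix C H)"
proof -
  have P: "pos_definite (matrix_inv C)"
    using assms(1) by (rule pos_definite_matrix_inv)
  have "pos_definite (matrix_inv (H ** matrix_inv C ** transpose H))"
    using pos_definite_congruence[OF P assms(2)] by (rule pos_definite_matrix_inv)
  with P show ?thesis
    by (simp add: pos_definite_def symmetric_matrix_def restr_matrix_def transpose_diff
        matrix_transpose_mul matrix_mul_assoc)
qed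

text \<open>The form of the subtracted matrix at \<open>x\<close> is y'Sy with y = HPx, where
  \<open>S\<close> is positive definite.\<close>

lemma restr_matrix_le_matrix_inv:
  fixes H :: "real^'n^'q"
  assumes "pos_definite C" "rank H = CARD('q)"
  shows "x \<bullet> (restr_matrix C H *v x) \<le> x \<bullet> (matrix_inv C *v x)"
proof -
  define P where "P = matrix_inv C"
  define S where "S = matrix_inv (H ** P ** transpose H)"
  have P: "pos_definite P"
    unfolding P_def using assms(1) by (rule pos_definite_matrix_inv)
  have S: "pos_definite S"
    unfolding S_def using pos_definite_congruence[OF P assms(2)] by (rule pos_definite_matrix_inv)
  define y where "y = H *v (P *v x)"
  have "restr_matrix C H *v x = P *v x - P *v (transpose H *v (S *v y))"
    unfolding restr_matrix_def y_def S_def P_def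
    by (simp only: matrix_vector_mult_diff_rdistrib matrix_vector_mul_assoc matrix_mul_assoc)
  moreover have "x \<bullet> (P *v (transpose H *v (S *v y))) = y \<bullet> (S *v y)"
    unfolding y_def
    by (simp only: symmetric_matrix_inner[OF pos_definite_symmetric[OF P]]
        inner_transpose_matrix_vector)
  ultimately show ?thesis
    using pos_definite_nonneg[OF S, of y] by (simp add: inner_diff_right P_def)
qed

text \<open>The bound on the restriction matrix is applied at Lv, the contraction at
  \<open>v\<close>; strictness of the contraction yields definiteness.\<close>

lemma pos_definite_inv_diff_liu_restr:
  fixes H :: "real^'n^'q"
  assumes "pos_definite C" "rank H = CARD('q)" "0 < d" "d < 1"
  shows "pos_definite (matrix_inv C - liu_matrix C d ** restr_matrix C H ** liu_matrix C d)"
  unfolding pos_definite_def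
proof (intro conjI allI impI)
  let ?L = "liu_matrix C d" and ?A = "restr_matrix C H"
  have L: "symmetric_matrix ?L"
    using assms(1) by (rule symmetric_liu_matrix)
  show "symmetric_matrix (matrix_inv C - ?L ** ?A ** ?L)"
    using L symmetric_restr_matrix[OF assms(1,2)]
      pos_definite_symmetric[OF pos_definite_matrix_inv[OF assms(1)]]
    by (simp add: symmetric_matrix_def transpose_diff matrix_transpose_mul matrix_mul_assoc)
  fix v :: "real^'n"
  assume "v \<noteq> 0"
  have "v \<bullet> ((?L ** ?A ** ?L) *v v) = (?L *v v) \<bullet> (?A *v (?L *v v))"
    unfolding symmetric_matrix_inner[OF L, symmetric] by (simp only: matrix_vector_mul_assoc matrix_mul_assoc)
  also have "\<dots> \<le> (?L *v v) \<bullet> (matrix_inv C *v (?L *v v))"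
    using assms by (intro restr_matrix_le_matrix_inv)
  also have "\<dots> < v \<bullet> (matrix_inv C *v v)"
    using assms \<open>v \<noteq> 0\<close> by (intro liu_matrix_contraction)
  finally show "0 < v \<bullet> ((matrix_inv C - ?L ** ?A ** ?L) *v v)"
    by (simp add: matrix_vector_mult_diff_rdistrib inner_diff_right)
qed

section \<open>Mean square error matrices\<close>

text \<open>Bias-variance decomposition: expanding the outer product of the error leaves cross terms
  linear in the centred variable, whose expectation is zero.\<close>

lemma mmse_affine:
  fixes X :: "'a \<Rightarrow> real^'n" and T :: "real^'n^'m"
  assumes "prob_space M" and X: "X \<in> borel_measurable M"
    and X2: "integrable M (\<lambda>\<omega>. (norm (X \<omega>))\<^sup>2)"
    and mean: "(\<integral>\<omega>. X \<omega> \<partial>M) = \<mu>"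
    and est: "\<And>\<omega>. est \<omega> - \<theta> = T *v (X \<omega> - \<mu>) + b"
  shows "mmse M est \<theta> = T ** cov_matrix M X ** transpose T + outer b b"
proof -
  interpret prob_space M by fact
  interpret outer: bounded_bilinear "outer :: real^'m \<Rightarrow> real^'m \<Rightarrow> _"
    by (rule bounded_bilinear_outer)
  interpret outer_n: bounded_bilinear "outer :: real^'n \<Rightarrow> real^'n \<Rightarrow> _"
    by (rule bounded_bilinear_outer)
  define Y where "Y \<omega> = X \<omega> - \<mu>" for \<omega>
  \<comment> \<open>A probability measure integrates constants, so r <= 1 + r^2 passes from the
    square to the variable itself.\<close>
  have intX: "integrable M X"
  proof (rule Bochner_Integration.integrable_bound)
    show "integrable M (\<lambda>\<omega>. 1 + (norm (X \<omega>))\<^sup>2)"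
      using X2 by simp
    have "r \<le> 1 + r\<^sup>2" for r :: real
    proof -
      have "2 * r \<le> 1 + r\<^sup>2"
        using zero_le_power2[of "r - 1"] by (simp add: power2_diff)
      then show ?thesis
        using zero_le_power2[of r] by linarith
    qed
    then show "AE \<omega> in M. norm (X \<omega>) \<le> norm (1 + (norm (X \<omega>))\<^sup>2)"
      by (intro AE_I2) (simp add: abs_of_nonneg)
  qed (rule X)
  have Ym: "Y \<in> borel_measurable M"
    unfolding Y_def using X by simp
  have intY: "integrable M Y"
    unfolding Y_def using intX by simp
  have EY: "(\<integral>\<omega>. Y \<omega> \<partial>M) = 0"
    unfolding Y_def using intX mean by (simp add: prob_space)
  have intYY: "integrable M (\<lambda>\<omega>. outer (Y \<omega>) (Y \<omega>))"
  proof (rule Bochner_Integration.integrable_bound)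
    show "integrable M (\<lambda>\<omega>. 2 * (norm (X \<omega>))\<^sup>2 + 2 * (norm \<mu>)\<^sup>2)"
      using X2 by simp
    show "(\<lambda>\<omega>. outer (Y \<omega>) (Y \<omega>)) \<in> borel_measurable M"
      using Ym
      by (intro borel_measurable_continuous_Pair[of Y M Y outer])
        (auto intro!: outer_n.continuous_on continuous_intros)
    \<comment> \<open>The triangle inequality and (a + b)^2 <= 2a^2 + 2b^2 give an integrable
      majorant.\<close>
    have "norm (outer (Y \<omega>) (Y \<omega>)) \<le> 2 * (norm (X \<omega>))\<^sup>2 + 2 * (norm \<mu>)\<^sup>2" for \<omega>
    proof -
      have "(norm (Y \<omega>))\<^sup>2 \<le> (norm (X \<omega>) + norm \<mu>)\<^sup>2"
        unfolding Y_def by (intro power_mono norm_triangle_ineq4) simp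
      also have "\<dots> \<le> 2 * (norm (X \<omega>))\<^sup>2 + 2 * (norm \<mu>)\<^sup>2"
        using zero_le_power2[of "norm (X \<omega>) - norm \<mu>"] by (simp add: power2_diff power2_sum)
      finally show ?thesis
        by (simp add: norm_outer power2_eq_square)
    qed
    then show "AE \<omega> in M. norm (outer (Y \<omega>) (Y \<omega>)) \<le> norm (2 * (norm (X \<omega>))\<^sup>2 + 2 * (norm \<mu>)\<^sup>2)"
      by (intro AE_I2) simp
  qed
  \<comment> \<open>Linear maps in finite dimension are bounded and hence commute with the Bochner
    integral of an integrable function.\<close>
  have congr: "bounded_linear (\<lambda>Z :: real^'n^'n. T ** Z ** transpose T)"
    by (intro linear_conv_bounded_linear[THEN iffD1] linearI)
      (simp_all add: matrix_add_ldistrib matrix_add_rdistrib matrix_scalar_ac scalar_matrix_assoc)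
  have lin: "bounded_linear (\<lambda>y. T *v y)"
    by (intro linear_conv_bounded_linear[THEN iffD1] matrix_vector_mul_linear)
  have intTY: "integrable M (\<lambda>\<omega>. T *v Y \<omega>)"
    using lin intY by (rule integrable_bounded_linear)
  have ETY: "(\<integral>\<omega>. T *v Y \<omega> \<partial>M) = 0"
    by (simp add: integral_bounded_linear[OF lin intY] EY)
  have cross1: "integrable M (\<lambda>\<omega>. outer (T *v Y \<omega>) b)" "(\<integral>\<omega>. outer (T *v Y \<omega>) b \<partial>M) = 0"
    using integrable_bounded_linear[OF outer.bounded_linear_left intTY]
      integral_bounded_linear[OF outer.bounded_linear_left intTY]
    by (simp_all add: ETY outer.zero_left)
  have cross2: "integrable M (\<lambda>\<omega>. outer b (T *v Y \<omega>))" "(\<integral>\<omega>. outer b (T *v Y \<omega>) \<partial>M) = 0"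
    using integrable_bounded_linear[OF outer.bounded_linear_right intTY]
      integral_bounded_linear[OF outer.bounded_linear_right intTY]
    by (simp_all add: ETY outer.zero_right)
  have intq: "integrable M (\<lambda>\<omega>. T ** outer (Y \<omega>) (Y \<omega>) ** transpose T)"
    using congr intYY by (rule integrable_bounded_linear)
  have "mmse M est \<theta> = (\<integral>\<omega>. T ** outer (Y \<omega>) (Y \<omega>) ** transpose T
      + outer (T *v Y \<omega>) b + outer b (T *v Y \<omega>) + outer b b \<partial>M)"
    unfolding mmse_def est Y_def[symmetric]
    by (simp add: outer.add_left outer.add_right outer_matrix_vector add_ac)
  also have "\<dots> = (\<integral>\<omega>. T ** outer (Y \<omega>) (Y \<omega>) ** transpose T \<partial>M) + outer b b"
    using intq cross1 cross2 by (simp add: prob_space)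
  also have "(\<integral>\<omega>. T ** outer (Y \<omega>) (Y \<omega>) ** transpose T \<partial>M) = T ** cov_matrix M X ** transpose T"
    using integral_bounded_linear[OF congr intYY] by (simp add: cov_matrix_def mean Y_def)
  finally show ?thesis .
qed

text \<open>Identifies \<open>restr_matrix\<close> as the covariance of the restricted MLE, whose
  error is \<open>B\<close> applied to that of the MLE. The reason is that \<open>B\<close> fixes
  every vector P B'x.\<close>

lemma restr_matrix_eq_congruence:
  fixes H :: "real^'n^'q"
  assumes "pos_definite C" "rank H = CARD('q)"
  defines "B \<equiv> mat 1 - matrix_inv C ** transpose H **
      matrix_inv (H ** matrix_inv C ** transpose H) ** H"
  shows "B ** matrix_inv C ** transpose B = restr_matrix C H"
proof -
  define P where "P = matrix_inv C"
  define S where "S = H ** P ** transpose H"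
  define R where "R = matrix_inv S"
  have P: "pos_definite P"
    unfolding P_def using assms(1) by (rule pos_definite_matrix_inv)
  have S: "pos_definite S"
    unfolding S_def using P assms(2) by (rule pos_definite_congruence)
  have tP: "transpose P = P"
    using P by (simp add: pos_definite_def symmetric_matrix_def)
  have tR: "transpose R = R"
    using pos_definite_matrix_inv[OF S] by (simp add: R_def pos_definite_def symmetric_matrix_def)
  have tB: "transpose B = mat 1 - transpose H ** R ** H ** P"
    by (simp add: B_def transpose_diff matrix_transpose_mul tP tR matrix_mul_assoc
        flip: P_def S_def R_def)
  have "B *v (P *v (transpose B *v x)) = restr_matrix C H *v x" for x
  proof -
    define y where "y = R *v (H *v (P *v x))"
    have 1: "transpose B *v x = x - transpose H *v y"
      unfolding tB y_def
      by (simp only: matrix_vector_mult_diff_rdistrib matrix_vector_mul_lid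
          matrix_vector_mul_assoc matrix_mul_assoc)
    have "R *v (H *v (P *v (transpose H *v y))) = R *v (S *v y)"
      unfolding S_def by (simp only: matrix_vector_mul_assoc matrix_mul_assoc)
    then have 2: "R *v (H *v (P *v (transpose H *v y))) = y"
      using pos_definite_invertible[OF S] by (simp only: R_def matrix_inv_vector_left)
    have B: "B *v z = z - P *v (transpose H *v (R *v (H *v z)))" for z
      unfolding B_def P_def S_def R_def
      by (simp only: matrix_vector_mult_diff_rdistrib matrix_vector_mul_lid
          matrix_vector_mul_assoc matrix_mul_assoc)
    have "restr_matrix C H *v x = P *v x - P *v (transpose H *v y)"
      unfolding restr_matrix_def y_def R_def S_def P_def
      by (simp only: matrix_vector_mult_diff_rdistrib matrix_vector_mul_assoc matrix_mul_assoc)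
    \<comment> \<open>By \<open>2\<close>, applying RH to Px - PH'y gives y - y = 0, so the
      correction made by \<open>B\<close> vanishes.\<close>
    then show ?thesis
      unfolding 1 B matrix_vector_mult_diff_distrib 2 by (simp add: y_def)
  qed
  then show ?thesis
    unfolding matrix_eq P_def by (metis matrix_vector_mul_assoc)
qed

text \<open>The bias is (L - I)\<beta> because the restricted MLE is unbiased under the
  restrictions; the covariance is the restricted one conjugated by the Liu matrix.\<close>

lemma mmse_raule:
  fixes mle :: "'a \<Rightarrow> real^'n" and H :: "real^'n^'q" and d :: real
  assumes "prob_space M" "mle \<in> borel_measurable M"
    "integrable M (\<lambda>\<omega>. (norm (mle \<omega>))\<^sup>2)" "(\<integral>\<omega>. mle \<omega> \<partial>M) = \<beta>"
    "cov_matrix M mle = matrix_inv C" "pos_definite C" "rank H = CARD('q)" "H *v \<beta> = h"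
  defines "b \<equiv> (liu_matrix C d - mat 1) *v \<beta>"
  shows "mmse M (\<lambda>\<omega>. raule C H h d (mle \<omega>)) \<beta>
    = liu_matrix C d ** restr_matrix C H ** liu_matrix C d + outer b b"
proof -
  define L where "L = liu_matrix C d"
  define Z where "Z = matrix_inv C ** transpose H ** matrix_inv (H ** matrix_inv C ** transpose H)"
  define B where "B = mat 1 - Z ** H"
  have "raule C H h d m - \<beta> = (L ** B) *v (m - \<beta>) + b" for m
  proof -
    have "(L ** B) *v (m - \<beta>) = L *v ((m - \<beta>) - Z *v (H *v (m - \<beta>)))"
      unfolding B_def
      by (simp only: matrix_vector_mult_diff_rdistrib matrix_vector_mul_lid flip: matrix_vector_mul_assoc)
    \<comment> \<open>Here H\<beta> = h turns Hm - h into H(m - \<beta>), which makes the error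
      affine in m - \<beta>.\<close>
    moreover have "raule C H h d m = L *v (m - Z *v (H *v (m - \<beta>)))"
      using assms(8)
      by (simp add: raule_def rmle_def L_def Z_def matrix_vector_mult_diff_distrib)
    ultimately show ?thesis
      by (simp add: b_def L_def matrix_vector_mult_diff_distrib matrix_vector_mult_diff_rdistrib)
  qed
  then have "mmse M (\<lambda>\<omega>. raule C H h d (mle \<omega>)) \<beta>
      = (L ** B) ** matrix_inv C ** transpose (L ** B) + outer b b"
    unfolding assms(5)[symmetric] by (rule mmse_affine[OF assms(1-4)])
  also have "(L ** B) ** matrix_inv C ** transpose (L ** B)
      = L ** (B ** matrix_inv C ** transpose B) ** transpose L"
    by (simp only: matrix_transpose_mul matrix_mul_assoc)
  also have "B ** matrix_inv C ** transpose B = restr_matrix C H"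
    unfolding B_def Z_def using assms(6,7) by (rule restr_matrix_eq_congruence)
  also have "transpose L = L"
    using symmetric_liu_matrix[OF assms(6), of d] by (simp add: L_def symmetric_matrix_def)
  finally show ?thesis
    by (simp add: L_def)
qed

theorem theorem3p5:
  fixes M :: "'a measure"
    and mle :: "'a \<Rightarrow> real^'n"
    and \<beta> b1 :: "real^'n"
    and C L A :: "real^'n^'n"
    and H :: "real^'n^'q"
    and h :: "real^'q"
    and d :: real
  assumes "prob_space M"
    and "mle \<in> borel_measurable M"
    and "integrable M (\<lambda>\<omega>. (norm (mle \<omega>))\<^sup>2)"
    and "pos_definite C"
    and "(\<integral>\<omega>. mle \<omega> \<partial>M) = \<beta>"
    and "cov_matrix M mle = matrix_inv C"
    and "rank H = CARD('q)"
    and "H *v \<beta> = h"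
    and "0 < d" and "d < 1"
    and "L = liu_matrix C d"
    and "A = restr_matrix C H"
    and "b1 = (L - mat 1) *v \<beta>"
    and "lambda_max (L ** A ** L ** C) \<le> 1"
  shows "mmse_superior M \<beta> (\<lambda>\<omega>. raule C H h d (mle \<omega>)) mle \<longleftrightarrow>
    b1 \<bullet> (moore_penrose (matrix_inv C - L ** A ** L) *v b1) \<le> 1 \<and>
    b1 \<in> column_space (matrix_inv C - L ** A ** L)"
proof -
  define D where "D = matrix_inv C - L ** A ** L"
  have D: "pos_definite D"
    unfolding D_def assms(11,12) using assms(4,7,9,10) by (rule pos_definite_inv_diff_liu_restr)
  \<comment> \<open>Since the MLE has mean \<beta>, its MMSE matrix and its covariance are the same
    integral.\<close>
  have "mmse M mle \<beta> = matrix_inv C"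
    using assms(5,6) by (simp add: mmse_def cov_matrix_def)
  moreover have "mmse M (\<lambda>\<omega>. raule C H h d (mle \<omega>)) \<beta> = L ** A ** L + outer b1 b1"
    unfolding assms(11-13) using assms(1-3,5,6,4,7,8) by (rule mmse_raule)
  ultimately have "mmse_superior M \<beta> (\<lambda>\<omega>. raule C H h d (mle \<omega>)) mle
      \<longleftrightarrow> nonneg_definite (D - outer b1 b1)"
    by (simp add: mmse_superior_def D_def diff_diff_eq)
  also have "\<dots> \<longleftrightarrow> b1 \<bullet> (matrix_inv D *v b1) \<le> 1"
    using D by (rule nonneg_definite_diff_outer_iff)
  \<comment> \<open>For invertible \<open>D\<close> the Moore-Penrose inverse is the ordinary one
    and the column space condition holds for every vector.\<close>
  finally show ?thesis
    using pos_definite_invertible[OF D]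
    by (simp add: moore_penrose_invertible column_space_invertible flip: D_def)
qed

end
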